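(* Let $F\colon\mathsf{C}\to\mathsf{D}$ be a functor. Then the Riguet kernel $\mathrm{K}^{\mathrm{r}}(F)$ of $F$ is a Riguet congruence on $\mathsf{C}$ if, and only if, $F$ is a Riguet-full functor.
   Context: A Riguet congruence on a category $\mathsf{C}$ is a pair $\Phi=(\Phi^{\mathrm{ob}},\Phi^{\mathrm{fl}})$ where $\Phi^{\mathrm{ob}}$ is an equivalence relation on $\mathrm{Ob}(\mathsf{C})$ and $\Phi^{\mathrm{fl}}$ assigns to all $(a,a'),(b,b')\in\Phi^{\mathrm{ob}}$ a subset $\Phi^{\mathrm{fl}}_{\left(\begin{smallmatrix}a&b\\ a'&b'\end{smallmatrix}\right)}\subseteq\mathrm{Hom}_{\mathsf{C}}(a,b)\times\mathrm{Hom}_{\mathsf{C}}(a',b')$ such that: (a) if $(a,b)\in\Phi^{\mathrm{ob}}$, then $(\mathrm{id}_a,\mathrm{id}_b)\in\Phi^{\mathrm{fl}}_{\left(\begin{smallmatrix}a&a\\ b&b\end{smallmatrix}\right)}$; (b) if $f\in\mathrm{Hom}_{\mathsf{C}}(a,b)$, then $(f,f)\in\Phi^{\mathrm{fl}}_{\left(\begin{smallmatrix}a&b\\ a&b\end{smallmatrix}\right)}$; (c) if $(f,f')\in\Phi^{\mathrm{fl}}_{\left(\begin{smallmatrix}a&b\\ a'&b'\end{smallmatrix}\right)}$, then $(f',f)\in\Phi^{\mathrm{fl}}_{\left(\begin{smallmatrix}a'&b'\\ a&b\end{smallmatrix}\right)}$; (d) if $(f,f')\in\Phi^{\mathrm{fl}}_{\left(\begin{smallmatrix}a&b\\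 a'&b'\end{smallmatrix}\right)}$ and $(f',f'')\in\Phi^{\mathrm{fl}}_{\left(\begin{smallmatrix}a'&b'\\ a''&b''\end{smallmatrix}\right)}$, then $(f,f'')\in\Phi^{\mathrm{fl}}_{\left(\begin{smallmatrix}a&b\\ a''&b''\end{smallmatrix}\right)}$; (e) if $(f,f')\in\Phi^{\mathrm{fl}}_{\left(\begin{smallmatrix}a&b\\ a'&b'\end{smallmatrix}\right)}$ and $(g,g')\in\Phi^{\mathrm{fl}}_{\left(\begin{smallmatrix}b&c\\ b'&c'\end{smallmatrix}\right)}$, then $(g\circ f,g'\circ f')\in\Phi^{\mathrm{fl}}_{\left(\begin{smallmatrix}a&c\\ a'&c'\end{smallmatrix}\right)}$; (f) for all $(a,a'),(b,b')\in\Phi^{\mathrm{ob}}$ and $f\in\mathrm{Hom}_{\mathsf{C}}(a,b)$ there is $f'\in\mathrm{Hom}_{\mathsf{C}}(a',b')$ with $(f,f')\in\Phi^{\mathrm{fl}}_{\left(\begin{smallmatrix}a&b\\ a'&b'\end{smallmatrix}\right)}$. A functor $F\colon\mathsf{C}\to\mathsf{D}$ is Riguet-full if, for all objects $a,a',b,b'$ of $\mathsf{C}$ and every $f\in\mathrm{Hom}_{\mathsf{C}}(a,b)$, if $F(a)=F(a')$ and $F(b)=F(b')$, then there is $f'\in\mathrm{Hom}_{\mathsf{C}}(a',b')$ with $F(f)=F(f')$. The Riguet kernel of $F$ is the pair $\mathrm{K}^{\mathrm{r}}(F)$ with $\mathrm{K}^{\mathrm{r}}(F)^{\mathrm{ob}}=\{(a,a')\mid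 F(a)=F(a')\}$ and, for $(a,a'),(b,b')\in\mathrm{K}^{\mathrm{r}}(F)^{\mathrm{ob}}$, $\mathrm{K}^{\mathrm{r}}(F)^{\mathrm{fl}}_{\left(\begin{smallmatrix}a&b\\ a'&b'\end{smallmatrix}\right)}=\{(f,f')\in\mathrm{Hom}_{\mathsf{C}}(a,b)\times\mathrm{Hom}_{\mathsf{C}}(a',b')\mid F(f)=F(f')\}$. *)

theory Defs
  imports Main
begin

(* Categories are given by families of hom-sets. These need not be pairwise disjoint, so
   composition (and the action of a functor on morphisms) also takes the objects as
   arguments: Comp C a b c g f is the composite "g after f" of f in Hom C a b and
   g in Hom C b c. *)

record ('o, 'm) cat_data =
  Ob :: "'o set"
  Hom :: "'o \<Rightarrow> 'o \<Rightarrow> 'm set"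
  Id :: "'o \<Rightarrow> 'm"
  Comp :: "'o \<Rightarrow> 'o \<Rightarrow> 'o \<Rightarrow> 'm \<Rightarrow> 'm \<Rightarrow> 'm"

locale category =
  fixes C :: "('o, 'm) cat_data"
  assumes Id_in_Hom: "a \<in> Ob C \<Longrightarrow> Id C a \<in> Hom C a a"
    and Comp_in_Hom:
      "\<lbrakk>a \<in> Ob C; b \<in> Ob C; c \<in> Ob C; f \<in> Hom C a b; g \<in> Hom C b c\<rbrakk>
        \<Longrightarrow> Comp C a b c g f \<in> Hom C a c"
    and Comp_Id_right:
      "\<lbrakk>a \<in> Ob C; b \<in> Ob C; f \<in> Hom C a b\<rbrakk> \<Longrightarrow> Comp C a a b f (Id C a) = f"
    and Comp_Id_left:
      "\<lbrakk>a \<in> Ob C; b \<in> Ob C; f \<in> Hom C a b\<rbrakk> \<Longrightarrow> Comp C a b b (Id C b) f = f"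
    and Comp_assoc:
      "\<lbrakk>a \<in> Ob C; b \<in> Ob C; c \<in> Ob C; d \<in> Ob C;
        f \<in> Hom C a b; g \<in> Hom C b c; h \<in> Hom C c d\<rbrakk>
        \<Longrightarrow> Comp C a c d h (Comp C a b c g f) = Comp C a b d (Comp C b c d h g) f"

record ('o, 'm, 'p, 'n) functor_data =
  obmap :: "'o \<Rightarrow> 'p"
  flmap :: "'o \<Rightarrow> 'o \<Rightarrow> 'm \<Rightarrow> 'n"

locale cat_functor = dom: category C + cod: category D
  for C :: "('o, 'm) cat_data" and D :: "('p, 'n) cat_data" +
  fixes F :: "('o, 'm, 'p, 'n) functor_data"
  assumes obmap_in_Ob: "a \<in> Ob C \<Longrightarrow> obmap F a \<in> Ob D"
    and flmap_in_Hom: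
      "\<lbrakk>a \<in> Ob C; b \<in> Ob C; f \<in> Hom C a b\<rbrakk>
        \<Longrightarrow> flmap F a b f \<in> Hom D (obmap F a) (obmap F b)"
    and flmap_Id: "a \<in> Ob C \<Longrightarrow> flmap F a a (Id C a) = Id D (obmap F a)"
    and flmap_Comp:
      "\<lbrakk>a \<in> Ob C; b \<in> Ob C; c \<in> Ob C; f \<in> Hom C a b; g \<in> Hom C b c\<rbrakk>
        \<Longrightarrow> flmap F a c (Comp C a b c g f)
          = Comp D (obmap F a) (obmap F b) (obmap F c) (flmap F b c g) (flmap F a b f)"

(* relfl P a b a' b' is the relation between Hom(a,b) and Hom(a',b'), the matrix index
   (a b; a' b') being read row by row. It is meaningful only for (a,a') and (b,b') in
   relob P; its values at other indices are never used. *)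

record ('o, 'm) riguet_data =
  relob :: "('o \<times> 'o) set"
  relfl :: "'o \<Rightarrow> 'o \<Rightarrow> 'o \<Rightarrow> 'o \<Rightarrow> ('m \<times> 'm) set"

locale riguet_congruence =
  fixes C :: "('o, 'm) cat_data" and P :: "('o, 'm) riguet_data"
  assumes equiv_relob: "equiv (Ob C) (relob P)"
    and relfl_subset:
      "\<lbrakk>(a, a') \<in> relob P; (b, b') \<in> relob P\<rbrakk>
        \<Longrightarrow> relfl P a b a' b' \<subseteq> Hom C a b \<times> Hom C a' b'"
    and relfl_Id:
      "(a, b) \<in> relob P \<Longrightarrow> (Id C a, Id C b) \<in> relfl P a a b b"
    and relfl_refl:
      "\<lbrakk>a \<in> Ob C; b \<in> Ob C; f \<in> Hom C a b\<rbrakk> \<Longrightarrow> (f, f) \<in> relfl P a b a b"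
    and relfl_sym:
      "\<lbrakk>(a, a') \<in> relob P; (b, b') \<in> relob P; (f, f') \<in> relfl P a b a' b'\<rbrakk>
        \<Longrightarrow> (f', f) \<in> relfl P a' b' a b"
    and relfl_trans:
      "\<lbrakk>(a, a') \<in> relob P; (b, b') \<in> relob P; (a', a'') \<in> relob P; (b', b'') \<in> relob P;
        (f, f') \<in> relfl P a b a' b'; (f', f'') \<in> relfl P a' b' a'' b''\<rbrakk>
        \<Longrightarrow> (f, f'') \<in> relfl P a b a'' b''"
    and relfl_Comp:
      "\<lbrakk>(a, a') \<in> relob P; (b, b') \<in> relob P; (c, c') \<in> relob P;
        (f, f') \<in> relfl P a b a' b'; (g, g') \<in> relfl P b c b' c'\<rbrakk>
        \<Longrightarrow> (Comp C a b c g f, Comp C a' b' c' g' f') \<in> relfl P a c a' c'"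
    and relfl_lift:
      "\<lbrakk>(a, a') \<in> relob P; (b, b') \<in> relob P; f \<in> Hom C a b\<rbrakk>
        \<Longrightarrow> \<exists>f' \<in> Hom C a' b'. (f, f') \<in> relfl P a b a' b'"

definition riguet_full ::
    "('o, 'm) cat_data \<Rightarrow> ('o, 'm, 'p, 'n) functor_data \<Rightarrow> bool" where
  "riguet_full C F \<longleftrightarrow>
    (\<forall>a\<in>Ob C. \<forall>a'\<in>Ob C. \<forall>b\<in>Ob C. \<forall>b'\<in>Ob C. \<forall>f\<in>Hom C a b.
      obmap F a = obmap F a' \<and> obmap F b = obmap F b' \<longrightarrow>
      (\<exists>f'\<in>Hom C a' b'. flmap F a b f = flmap F a' b' f'))"

definition riguet_kernel ::
    "('o, 'm) cat_data \<Rightarrow> ('o, 'm, 'p, 'n) functor_data \<Rightarrow> ('o, 'm) riguet_data" where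
  "riguet_kernel C F = \<lparr>
    relob = {(a, a'). a \<in> Ob C \<and> a' \<in> Ob C \<and> obmap F a = obmap F a'},
    relfl = (\<lambda>a b a' b'. {(f, f'). f \<in> Hom C a b \<and> f' \<in> Hom C a' b' \<and>
                              flmap F a b f = flmap F a' b' f'})\<rparr>"

end

theory Submission
  imports Defs
begin

text \<open>
  Being related by the Riguet kernel of a functor means having the same image under it.
  The equivalence laws and the compatibility with identities and composition required of a
  Riguet congruence therefore hold for every functor: equality in the
  target category is an equivalence relation, and a functor sends identities and composites
  to identities and composites that depend only on the images. The remaining condition, that
  every morphism lifts along related objects, is word for word Riguet-fullness once membership
  in the kernel is written out. This equivalence is \<open>riguet_kernel_lift_iff_full\<close>; the two
  conditions that use functoriality are \<open>riguet_kernel_Id\<close> and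
  \<open>riguet_kernel_Comp\<close>.
\<close>

lemma relob_riguet_kernel_iff:
  "(a, a') \<in> relob (riguet_kernel C F) \<longleftrightarrow> a \<in> Ob C \<and> a' \<in> Ob C \<and> obmap F a = obmap F a'"
  by (simp add: riguet_kernel_def)

lemma relfl_riguet_kernel_iff:
  "(f, f') \<in> relfl (riguet_kernel C F) a b a' b' \<longleftrightarrow>
    f \<in> Hom C a b \<and> f' \<in> Hom C a' b' \<and> flmap F a b f = flmap F a' b' f'"
  by (simp add: riguet_kernel_def)

lemma equiv_relob_riguet_kernel: "equiv (Ob C) (relob (riguet_kernel C F))"
  by (auto simp: relob_riguet_kernel_iff intro!: equivI refl_onI symI transI)

text \<open>
  Congruence and fullness quantify over the same quadruples of objects, and membership of
  \<open>(f, f')\<close> in the kernel is exactly the equation that fullness asks of \<open>f'\<close>.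
\<close>

lemma riguet_kernel_lift_iff_full:
  "(\<forall>a a' b b' f. (a, a') \<in> relob (riguet_kernel C F) \<longrightarrow> (b, b') \<in> relob (riguet_kernel C F) \<longrightarrow>
      f \<in> Hom C a b \<longrightarrow> (\<exists>f'\<in>Hom C a' b'. (f, f') \<in> relfl (riguet_kernel C F) a b a' b'))
    \<longleftrightarrow> riguet_full C F"
  unfolding riguet_full_def relob_riguet_kernel_iff relfl_riguet_kernel_iff by blast

context cat_functor
begin

lemma riguet_kernel_Id:
  assumes "(a, b) \<in> relob (riguet_kernel C F)"
  shows "(Id C a, Id C b) \<in> relfl (riguet_kernel C F) a a b b"
  using assms
  by (simp add: relob_riguet_kernel_iff relfl_riguet_kernel_iff dom.Id_in_Hom flmap_Id)

text \<open>
  By functoriality both composites are sent to a composite in the target formed at the images of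
  the three objects. These indices have to be replaced along with the morphisms, so the
  relatedness of all the objects, the middle ones included, is used.
\<close>

lemma riguet_kernel_Comp:
  assumes "(a, a') \<in> relob (riguet_kernel C F)" "(b, b') \<in> relob (riguet_kernel C F)"
    "(c, c') \<in> relob (riguet_kernel C F)"
    and "(f, f') \<in> relfl (riguet_kernel C F) a b a' b'"
    and "(g, g') \<in> relfl (riguet_kernel C F) b c b' c'"
  shows "(Comp C a b c g f, Comp C a' b' c' g' f') \<in> relfl (riguet_kernel C F) a c a' c'"
  using assms
  by (simp add: relob_riguet_kernel_iff relfl_riguet_kernel_iff dom.Comp_in_Hom flmap_Comp)

lemma riguet_congruence_kernel_if_full:
  assumes "riguet_full C F"
  shows "riguet_congruence C (riguet_kernel C F)"
proof
  show "equiv (Ob C) (relob (riguet_kernel C F))"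
    by (rule equiv_relob_riguet_kernel)
  show "\<exists>f'\<in>Hom C a' b'. (f, f') \<in> relfl (riguet_kernel C F) a b a' b'"
    if "(a, a') \<in> relob (riguet_kernel C F)" "(b, b') \<in> relob (riguet_kernel C F)"
      "f \<in> Hom C a b" for a a' b b' f
    using assms that unfolding riguet_kernel_lift_iff_full [symmetric] by blast
qed ((rule riguet_kernel_Id riguet_kernel_Comp; assumption) |
    (auto simp: relfl_riguet_kernel_iff)[1])+

end

theorem proposition2p13:
  fixes C :: "('o, 'm) cat_data" and D :: "('p, 'n) cat_data"
    and F :: "('o, 'm, 'p, 'n) functor_data"
  assumes "cat_functor C D F"
  shows "riguet_congruence C (riguet_kernel C F) \<longleftrightarrow> riguet_full C F"
proof
  assume "riguet_congruence C (riguet_kernel C F)"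
  then interpret riguet_congruence C "riguet_kernel C F" .
  show "riguet_full C F"
    unfolding riguet_kernel_lift_iff_full [symmetric] using relfl_lift by blast
next
  assume "riguet_full C F"
  with assms show "riguet_congruence C (riguet_kernel C F)"
    by (rule cat_functor.riguet_congruence_kernel_if_full)
qed

end
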